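(* Let $\pi\in\Pi_{\mathsf a}$. The equilibrium point $x_{\mathsf e}=0$ of the system $\dot X_t=f_\pi(X_t)$ is (1) stable if $\alpha J_\pi(x)\le c_\pi(x)$ for all $x\in\mathcal X$; (2) asymptotically stable if $\alpha J_\pi(x)<c_\pi(x)$ for all $x\in\mathcal X\setminus\{0\}$; (3) globally asymptotically stable if $\gamma=1$ or if, in addition to the condition in (2), $J_\pi$ is radially unbounded.
   Context: Nonlinear optimal control setting. State space $\mathcal X=\mathbb R^l$, $\mathcal X^{\mathsf T}=\mathbb R^{1\times l}$, time space $\mathbb T=[0,\infty)$; the action space $\mathcal U\subseteq\mathbb R^m$ (a set $O\cup\partial O$ or $O$ with $O$ open in $\mathbb R^m$) contains $0$. The system is $\dot X_t=f(X_t,U_t)$ with $f:\mathcal X\times\mathcal U\to\mathcal X$ locally Lipschitz and $f(0,0)=0$. The cost function $c:\mathcal X\times\mathcal U\to\mathbb R$ is continuous and positive definite: $c(0,0)=0$ and $c(x,u)>0$ for $(x,u)\ne(0,0)$; the reward is $r=-c$, and $C_t=c(X_t,U_t)$. $\gamma\in(0,1]$ is the discount factor, $\alpha=-\ln\gamma\ge0$. The Hamiltonian is $h(x,u,p)=-c(x,u)+p\,f(x,u)$, and it is assumed there is a locally Lipschitz $u_*:\mathcal X\times\mathcal X^{\mathsf T}\to\mathcal U$ with $u_*(x,p)\in\arg\max_{u\in\mathcal U}h(x,u,p)$ for all $(x,p)$. A policy is a continuous function $\pi:\mathcal X\to\mathcal U$; write $f_\pi(x)=f(x,\pi(x))$,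 $c_\pi(x)=c(x,\pi(x))$. $\Pi_0$ is the set of locally Lipschitz policies with $\pi(0)=0$. For a locally Lipschitz policy $\pi$ and $x\in\mathcal X$, $[0,t_{\mathsf{max}}(x;\pi))$ with $t_{\mathsf{max}}(x;\pi)\in(0,\infty]$ is the maximal forward existence interval of the unique solution of $\dot X_t=f_\pi(X_t)$, $X_0=x$ (global existence is not assumed); $\mathbb G_\pi^x[Y]$ denotes the value of $Y$ along that solution with $U_t=\pi(X_t)$. The cost value function is $J_\pi(x)=\mathbb G_\pi^x[\int_0^\infty\gamma^tC_t\,dt]\in[0,\infty]$ if $t_{\mathsf{max}}(x;\pi)=\infty$ and $J_\pi(x)=\infty$ otherwise; $v_\pi=-J_\pi$. $\Pi_{\mathsf a}=\{\pi\in\Pi_0: J_\pi(x)<\infty\ \forall x\in\mathcal X\}$ (assumed nonempty). Standing assumptions: for every $\pi\in\Pi_{\mathsf a}$, $v_\pi$ is $\mathrm C^1$ with locally Lipschitz gradient; for every $\pi\in\Pi_0$, $c_\pi$ is radially nonvanishing, i.e., $\inf_{\|x\|\ge\rho}|c_\pi(x)|\not\to0$ as $\rho\to\infty$. A function $g:\mathcal X\to\mathbb R$ is radially unbounded iff $\inf_{\|x\|\ge\rho}|g(x)|\to\infty$ as $\rho\to\infty$. Stability notions are the usual ones of Lyapunov. *)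

theory Defs
  imports "HOL-Analysis.Analysis"
begin

section \<open>Regularity and growth\<close>

text \<open>\<^const>\<open>local_lipschitz\<close> is stated for time-dependent maps; here the time argument is a dummy.\<close>

definition locally_lipschitz_on :: "'a::metric_space set \<Rightarrow> ('a \<Rightarrow> 'b::metric_space) \<Rightarrow> bool" where
  "locally_lipschitz_on S g \<longleftrightarrow> local_lipschitz (UNIV :: real set) S (\<lambda>_. g)"

definition C1_locally_lipschitz_gradient :: "('a::real_inner \<Rightarrow> real) \<Rightarrow> bool" where
  "C1_locally_lipschitz_gradient v \<longleftrightarrow>
     (\<exists>g. (\<forall>x. GDERIV v x :> g x) \<and> continuous_on UNIV g \<and> locally_lipschitz_on UNIV g)"

definition radially_nonvanishing :: "('a::real_normed_vector \<Rightarrow> real) \<Rightarrow> bool" where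
  "radially_nonvanishing g \<longleftrightarrow>
     \<not> ((\<lambda>\<rho>::real. INF x\<in>{x. \<rho> \<le> norm x}. \<bar>g x\<bar>) \<longlongrightarrow> 0) at_top"

definition radially_unbounded :: "('a::real_normed_vector \<Rightarrow> real) \<Rightarrow> bool" where
  "radially_unbounded g \<longleftrightarrow>
     filterlim (\<lambda>\<rho>::real. INF x\<in>{x. \<rho> \<le> norm x}. \<bar>g x\<bar>) at_top at_top"

section \<open>Autonomous systems and Lyapunov stability\<close>

text \<open>\<open>X\<close> solves \<open>X' = F X\<close>, \<open>X 0 = x\<close> on \<open>[0,T)\<close>; the derivative is one-sided at \<open>0\<close>.\<close>

definition solves_on ::
  "('a::real_normed_vector \<Rightarrow> 'a) \<Rightarrow> 'a \<Rightarrow> ereal \<Rightarrow> (real \<Rightarrow> 'a) \<Rightarrow> bool" where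
  "solves_on F x T X \<longleftrightarrow> X 0 = x \<and>
     (\<forall>t\<ge>0. ereal t < T \<longrightarrow> (X has_vector_derivative F (X t)) (at t within {0..}))"

definition t_max :: "('a::real_normed_vector \<Rightarrow> 'a) \<Rightarrow> 'a \<Rightarrow> ereal" where
  "t_max F x = Sup {T. 0 < T \<and> (\<exists>X. solves_on F x T X)}"

text \<open>For locally Lipschitz \<open>F\<close> the solution is unique on \<open>[0, t_max F x)\<close>, so the choice below is
  determined there; its values at other times are arbitrary and carry no meaning.\<close>

definition flow :: "('a::real_normed_vector \<Rightarrow> 'a) \<Rightarrow> 'a \<Rightarrow> real \<Rightarrow> 'a" where
  "flow F x = (SOME X. solves_on F x (t_max F x) X)"

definition lyapunov_stable :: "('a::real_normed_vector \<Rightarrow> 'a) \<Rightarrow> 'a \<Rightarrow> bool" where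
  "lyapunov_stable F xe \<longleftrightarrow> F xe = 0 \<and>
     (\<forall>\<epsilon>>0. \<exists>\<delta>>0. \<forall>x. norm (x - xe) < \<delta> \<longrightarrow>
        t_max F x = \<infinity> \<and> (\<forall>t\<ge>0. norm (flow F x t - xe) < \<epsilon>))"

definition asymptotically_stable :: "('a::real_normed_vector \<Rightarrow> 'a) \<Rightarrow> 'a \<Rightarrow> bool" where
  "asymptotically_stable F xe \<longleftrightarrow> lyapunov_stable F xe \<and>
     (\<exists>\<delta>>0. \<forall>x. norm (x - xe) < \<delta> \<longrightarrow> t_max F x = \<infinity> \<and> (flow F x \<longlongrightarrow> xe) at_top)"

definition globally_asymptotically_stable :: "('a::real_normed_vector \<Rightarrow> 'a) \<Rightarrow> 'a \<Rightarrow> bool" where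
  "globally_asymptotically_stable F xe \<longleftrightarrow> lyapunov_stable F xe \<and>
     (\<forall>x. t_max F x = \<infinity> \<and> (flow F x \<longlongrightarrow> xe) at_top)"

section \<open>The optimal control problem\<close>

text \<open>The row vector \<open>p\<close> is represented by its transpose, so \<open>p f(x,u)\<close> becomes an inner product.\<close>

definition hamiltonian ::
  "('x \<Rightarrow> 'u \<Rightarrow> real) \<Rightarrow> ('x \<Rightarrow> 'u \<Rightarrow> 'x::real_inner) \<Rightarrow> 'x \<Rightarrow> 'u \<Rightarrow> 'x \<Rightarrow> real" where
  "hamiltonian c f x u p = - c x u + p \<bullet> f x u"

definition closed_loop :: "('x \<Rightarrow> 'u \<Rightarrow> 'y) \<Rightarrow> ('x \<Rightarrow> 'u) \<Rightarrow> 'x \<Rightarrow> 'y" where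
  "closed_loop f \<pi> x = f x (\<pi> x)"

definition policies :: "'u::metric_space set \<Rightarrow> ('x::metric_space \<Rightarrow> 'u) set" where
  "policies U = {\<pi>. (\<forall>x. \<pi> x \<in> U) \<and> continuous_on UNIV \<pi>}"

definition policies\<^sub>0 ::
  "'u::real_normed_vector set \<Rightarrow> ('x::real_normed_vector \<Rightarrow> 'u) set" where
  "policies\<^sub>0 U = {\<pi> \<in> policies U. locally_lipschitz_on UNIV \<pi> \<and> \<pi> 0 = 0}"

text \<open>\<^const>\<open>ennreal\<close> truncates negative reals to \<open>0\<close>, which is harmless for a nonnegative cost.\<close>

definition cost_ext :: "real \<Rightarrow> ('x::real_normed_vector \<Rightarrow> 'u \<Rightarrow> 'x) \<Rightarrow> ('x \<Rightarrow> 'u \<Rightarrow> real) \<Rightarrow>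
    ('x \<Rightarrow> 'u) \<Rightarrow> 'x \<Rightarrow> ennreal" where
  "cost_ext \<gamma> f c \<pi> x =
     (if t_max (closed_loop f \<pi>) x = \<infinity>
      then \<integral>\<^sup>+ t\<in>{0..}. ennreal (\<gamma> powr t * closed_loop c \<pi> (flow (closed_loop f \<pi>) x t)) \<partial>lborel
      else \<infinity>)"

definition admissible :: "'u::real_normed_vector set \<Rightarrow> real \<Rightarrow>
    ('x::real_normed_vector \<Rightarrow> 'u \<Rightarrow> 'x) \<Rightarrow> ('x \<Rightarrow> 'u \<Rightarrow> real) \<Rightarrow> ('x \<Rightarrow> 'u) set" where
  "admissible U \<gamma> f c = {\<pi> \<in> policies\<^sub>0 U. \<forall>x. cost_ext \<gamma> f c \<pi> x < \<infinity>}"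

text \<open>The real-valued cost; it agrees with \<open>cost_ext\<close> exactly where the latter is finite, hence
  everywhere when \<open>\<pi>\<close> is admissible. It is only meant to be used in that case.\<close>

definition cost :: "real \<Rightarrow> ('x::real_normed_vector \<Rightarrow> 'u \<Rightarrow> 'x) \<Rightarrow> ('x \<Rightarrow> 'u \<Rightarrow> real) \<Rightarrow>
    ('x \<Rightarrow> 'u) \<Rightarrow> 'x \<Rightarrow> real" where
  "cost \<gamma> f c \<pi> x = enn2real (cost_ext \<gamma> f c \<pi> x)"

end

theory Submission
  imports Defs
begin

text \<open>
  Along a trajectory the tail of the cost integral is again a value, so \<open>V = J\<^sub>\<pi>\<close> satisfies
  \<open>V' = \<alpha> V - c\<^sub>\<pi>\<close> by differentiating the integral alone. Since \<open>J\<^sub>\<pi>\<close> is continuous and positive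
  definite, the hypotheses of (1) and (2) make it a weak, respectively strict, Lyapunov function.
  For \<open>\<gamma> = 1\<close> sublevel sets of \<open>J\<^sub>\<pi>\<close> may be unbounded, but \<open>c\<^sub>\<pi>\<close> is bounded away from \<open>0\<close> outside
  every neighbourhood of the origin, so a trajectory that avoided such a neighbourhood would have
  infinite cost. Once trajectories meet every neighbourhood of \<open>0\<close>, stability turns this into
  convergence.
\<close>

section \<open>Solutions of autonomous systems\<close>

lemma solves_on_subinterval:
  assumes "solves_on F x T X" "T' \<le> T"
  shows "solves_on F x T' X"
  using assms unfolding solves_on_def by (auto dest: less_le_trans)

text \<open>Gronwall's argument in differential form: the squared distance of the two solutions,
  multiplied by a decaying exponential, cannot increase, and it starts at 0.\<close>

lemma solves_on_unique:
  fixes F :: "'a::real_inner \<Rightarrow> 'a"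
  assumes lip: "\<And>K. compact K \<Longrightarrow> \<exists>L. L-lipschitz_on K F"
    and X: "solves_on F x T X" and Y: "solves_on F x T' Y"
    and t: "0 \<le> t" "ereal t < T" "ereal t < T'"
  shows "X t = Y t"
proof -
  have less: "ereal s < T" "ereal s < T'" if "s \<in> {0..t}" for s
    using t that by (auto intro: le_less_trans[of _ "ereal t"])
  have dX: "(X has_vector_derivative F (X s)) (at s within {0..})"
    and dY: "(Y has_vector_derivative F (Y s)) (at s within {0..})" if "s \<in> {0..t}" for s
    using X Y less[OF that] that unfolding solves_on_def by auto
  have cont: "continuous_on {0..t} X" "continuous_on {0..t} Y"
    by (auto intro!: continuous_on_vector_derivative
        has_vector_derivative_within_subset[OF dX] has_vector_derivative_within_subset[OF dY])
  \<comment> \<open>Both arcs go into one compact set, so that a single constant \<open>L\<close>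
    compares \<open>F\<close> at \<open>X s\<close> with \<open>F\<close> at
    \<open>Y s\<close>.\<close>
  have "compact (X ` {0..t} \<union> Y ` {0..t})"
    using cont by (auto intro: compact_continuous_image)
  then obtain L where L: "L-lipschitz_on (X ` {0..t} \<union> Y ` {0..t}) F"
    using lip by blast
  \<comment> \<open>The squared distance grows at rate at most \<open>2 * L\<close> times itself;
    the weight compensates exactly this growth.\<close>
  define d where "d s = exp (- 2 * L * s) * ((X s - Y s) \<bullet> (X s - Y s))" for s
  have "d t \<le> d 0"
  proof (rule DERIV_nonpos_imp_decreasing_open[OF t(1)])
    fix s assume s: "0 < s" "s < t"
    have "at s within {0..} = at s"
      using s by (intro at_within_interior) auto
    then have D: "(X has_vector_derivative F (X s)) (at s)" "(Y has_vector_derivative F (Y s)) (at s)"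
      using dX[of s] dY[of s] s by auto
    let ?e = "X s - Y s" and ?g = "F (X s) - F (Y s)"
    have "(d has_real_derivative exp (- 2 * L * s) * (2 * (?e \<bullet> ?g) - 2 * L * (?e \<bullet> ?e))) (at s)"
      unfolding d_def has_field_derivative_def
      using D[unfolded has_vector_derivative_def]
      by (auto intro!: derivative_eq_intros simp: algebra_simps inner_commute fun_eq_iff)
    moreover have "?e \<bullet> ?g \<le> L * (?e \<bullet> ?e)"
    proof -
      have "norm ?g \<le> L * norm ?e"
        using lipschitz_onD[OF L, of "X s" "Y s"] s by (auto simp: dist_norm)
      then have "norm ?e * norm ?g \<le> norm ?e * (L * norm ?e)"
        by (intro mult_left_mono) auto
      moreover have "?e \<bullet> ?g \<le> norm ?e * norm ?g"
        by (rule norm_cauchy_schwarz)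
      ultimately show ?thesis
        by (simp add: dot_square_norm power2_eq_square algebra_simps)
    qed
    ultimately show "\<exists>y. DERIV d s :> y \<and> y \<le> 0"
      by (intro exI conjI) (assumption, simp add: mult_nonneg_nonpos)
  next
    show "continuous_on {0..t} d"
      unfolding d_def using cont by (intro continuous_intros)
  qed
  moreover have "d 0 = 0"
    using X Y by (simp add: d_def solves_on_def)
  ultimately have "(X t - Y t) \<bullet> (X t - Y t) \<le> 0"
    by (simp add: d_def mult_le_0_iff)
  then show ?thesis
    by (metis inner_gt_zero_iff linorder_not_less right_minus_eq)
qed

text \<open>Since \<open>t_max\<close> is a supremum, its being infinite yields a solution on each
  bounded interval but not at once a single one for all times. Uniqueness lets these be glued, so
  the choice in \<open>flow\<close> picks a genuine global solution.\<close>

lemma solves_on_flow: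
  fixes F :: "'a::real_inner \<Rightarrow> 'a"
  assumes lip: "\<And>K. compact K \<Longrightarrow> \<exists>L. L-lipschitz_on K F"
    and global: "t_max F x = \<infinity>"
  shows "solves_on F x \<infinity> (flow F x)"
proof -
  have "\<exists>X. solves_on F x (ereal s) X" for s :: real
  proof -
    have "ereal s < Sup {T. 0 < T \<and> (\<exists>X. solves_on F x T X)}"
      using global by (simp add: t_max_def)
    then show ?thesis
      by (auto simp: less_Sup_iff intro: solves_on_subinterval less_imp_le)
  qed
  then obtain Y where Y: "\<And>s. solves_on F x (ereal s) (Y s)"
    by metis
  \<comment> \<open>The extra unit of time puts \<open>t\<close> strictly inside the interval of
    \<open>Y (t + 1)\<close>; hence \<open>Z\<close> agrees with that one solution at all
    nonnegative times within distance 1 of \<open>t\<close> and inherits its derivative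
    there.\<close>
  define Z where "Z t = Y (t + 1) t" for t
  have Z: "Z t = Y s t" if "0 \<le> t" "t < s" for s t
    unfolding Z_def using that by (intro solves_on_unique[OF lip Y Y]) auto
  have "solves_on F x \<infinity> Z"
    unfolding solves_on_def
  proof (intro conjI allI impI)
    show "Z 0 = x"
      using Y[of 1] by (simp add: Z_def solves_on_def)
    fix t :: real assume t: "0 \<le> t"
    have "(Y (t + 1) has_vector_derivative F (Y (t + 1) t)) (at t within {0..})"
      using Y[of "t + 1"] t by (simp add: solves_on_def)
    then show "(Z has_vector_derivative F (Z t)) (at t within {0..})"
      unfolding Z_def[of t]
      by (rule has_vector_derivative_transform_within[where d = 1])
        (use t in \<open>auto simp: dist_real_def intro!: Z[symmetric]\<close>)
  qed
  then show ?thesis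
    unfolding flow_def global by (rule someI[of "solves_on F x \<infinity>"])
qed

text \<open>The closed loop of an admissible policy is of this kind, since a trajectory with finite
  escape time has infinite cost.\<close>

locale complete_system =
  fixes F :: "'a::euclidean_space \<Rightarrow> 'a"
  assumes lipschitz_compact: "compact K \<Longrightarrow> \<exists>L. L-lipschitz_on K F"
    and t_max_eq: "t_max F x = \<infinity>"
begin

lemma flow_0: "flow F x 0 = x"
  using solves_on_flow[OF lipschitz_compact t_max_eq] by (simp add: solves_on_def)

lemma flow_deriv:
  "0 \<le> t \<Longrightarrow> (flow F x has_vector_derivative F (flow F x t)) (at t within {0..})"
  using solves_on_flow[OF lipschitz_compact t_max_eq] by (simp add: solves_on_def)

lemma flow_eqI: "solves_on F x \<infinity> X \<Longrightarrow> 0 \<le> t \<Longrightarrow> flow F x t = X t"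
  by (rule solves_on_unique[OF lipschitz_compact solves_on_flow[OF lipschitz_compact t_max_eq]])
    auto

lemma flow_continuous: "continuous_on {0..} (flow F x)"
  by (rule continuous_on_vector_derivative[OF flow_deriv]) simp

lemma flow_equilibrium:
  assumes "F x = 0" "0 \<le> t"
  shows "flow F x t = x"
  by (rule flow_eqI) (use assms in \<open>auto simp: solves_on_def\<close>)

text \<open>The semigroup law: the equation is autonomous, so a time-shifted trajectory is again a
  solution, and uniqueness identifies it.\<close>

lemma flow_add:
  assumes "0 \<le> s" "0 \<le> t"
  shows "flow F (flow F x s) t = flow F x (s + t)"
proof (rule flow_eqI[OF _ assms(2)])
  show "solves_on F (flow F x s) \<infinity> (\<lambda>t. flow F x (s + t))"
    unfolding solves_on_def
  proof (intro conjI allI impI)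
    fix t :: real assume t: "0 \<le> t"
    have "((flow F x \<circ> (+) s) has_vector_derivative 1 *\<^sub>R F (flow F x (s + t))) (at t within {0..})"
    proof (rule vector_diff_chain_within)
      show "((+) s has_vector_derivative 1) (at t within {0..})"
        by (auto intro!: derivative_eq_intros)
      show "(flow F x has_vector_derivative F (flow F x (s + t))) (at (s + t) within (+) s ` {0..})"
        by (rule has_vector_derivative_within_subset[OF flow_deriv]) (use t assms in auto)
    qed
    then show "((\<lambda>t. flow F x (s + t)) has_vector_derivative F (flow F x (s + t))) (at t within {0..})"
      by (simp add: o_def)
  qed simp
qed

end

section \<open>Lyapunov functions\<close>

lemma compact_pos_lower_bound:
  fixes W :: "'a::topological_space \<Rightarrow> real"
  assumes "compact K" "continuous_on K W" "\<And>x. x \<in> K \<Longrightarrow> 0 < W x"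
  obtains w where "0 < w" "\<And>x. x \<in> K \<Longrightarrow> w \<le> W x"
proof (cases "K = {}")
  case True
  \<comment> \<open>This case arises for annuli whose outer radius is smaller than the inner
    one.\<close>
  then show ?thesis by (intro that[of 1]) auto
next
  case False
  then obtain y where "y \<in> K" "\<forall>x\<in>K. W y \<le> W x"
    using continuous_attains_inf[OF assms(1) _ assms(2)] by blast
  then show ?thesis using assms(3) by (intro that[of "W y"]) auto
qed

context complete_system
begin

text \<open>To leave the \<epsilon>-ball a trajectory must cross its sphere, where \<open>V\<close>
  is at least some \<open>m > 0\<close>. One that starts where \<open>V\<close> is below
  \<open>m\<close> cannot do so, as \<open>V\<close> never exceeds its initial value.\<close>

lemma lyapunov_stable_0I:
  fixes V :: "'a \<Rightarrow> real"
  assumes F0: "F 0 = 0" and cont: "continuous_on UNIV V"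
    and V0: "V 0 = 0" and pos: "\<And>x. x \<noteq> 0 \<Longrightarrow> 0 < V x"
    and decreasing: "\<And>x t. 0 \<le> t \<Longrightarrow> V (flow F x t) \<le> V x"
  shows "lyapunov_stable F 0"
  unfolding lyapunov_stable_def
proof (intro conjI allI impI F0)
  fix \<epsilon> :: real assume \<epsilon>: "0 < \<epsilon>"
  obtain m where m: "0 < m" "\<And>x. x \<in> sphere 0 \<epsilon> \<Longrightarrow> m \<le> V x"
  proof (rule compact_pos_lower_bound)
    show "compact (sphere (0::'a) \<epsilon>)" by simp
    show "continuous_on (sphere 0 \<epsilon>) V"
      using cont by (rule continuous_on_subset) simp
    show "0 < V x" if "x \<in> sphere 0 \<epsilon>" for x
      using that \<epsilon> by (intro pos) auto
  qed (rule that)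
  obtain \<delta> where \<delta>: "0 < \<delta>" "\<And>x. norm x < \<delta> \<Longrightarrow> V x < m"
  proof -
    have "\<forall>\<^sub>F x in nhds 0. V x < m"
      using cont m(1) V0 by (auto simp: continuous_on_eq_continuous_at isCont_def
          tendsto_at_iff_tendsto_nhds intro: order_tendstoD)
    then show ?thesis
      using that by (auto simp: eventually_nhds_metric dist_norm)
  qed
  show "\<exists>\<delta>>0. \<forall>x. norm (x - 0) < \<delta> \<longrightarrow>
      t_max F x = \<infinity> \<and> (\<forall>t\<ge>0. norm (flow F x t - 0) < \<epsilon>)"
  \<comment> \<open>The minimum makes the trajectory start inside the sphere, as the intermediate
    value theorem requires.\<close>
  proof (intro exI[of _ "min \<delta> \<epsilon>"] conjI allI impI t_max_eq)
    fix x :: 'a and t :: real assume x: "norm (x - 0) < min \<delta> \<epsilon>" and t: "0 \<le> t"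
    show "norm (flow F x t - 0) < \<epsilon>"
    proof (rule ccontr)
      assume "\<not> ?thesis"
      then have "\<exists>s\<ge>0. s \<le> t \<and> norm (flow F x s) = \<epsilon>"
        using t x by (intro IVT') (auto simp: flow_0 intro!: continuous_on_norm
            continuous_on_subset[OF flow_continuous])
      then obtain s where "0 \<le> s" "flow F x s \<in> sphere 0 \<epsilon>" by auto
      then show False
        using m(2)[of "flow F x s"] decreasing[of s x] \<delta>(2)[of x] x by simp
    qed
  qed (use \<delta> \<epsilon> in auto)
qed

text \<open>One visit to the \<delta>-ball that stability assigns to \<epsilon> suffices: restarting
  the flow at that moment keeps it in the \<epsilon>-ball forever.\<close>

lemma flow_tendsto_0:
  assumes stable: "lyapunov_stable F 0"
    and meets: "\<And>\<delta>. 0 < \<delta> \<Longrightarrow> \<exists>s\<ge>0. norm (flow F x s) < \<delta>"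
  shows "(flow F x \<longlongrightarrow> 0) at_top"
proof (rule tendstoI)
  fix \<epsilon> :: real assume "0 < \<epsilon>"
  then obtain \<delta> where \<delta>: "0 < \<delta>" "\<And>y t. norm y < \<delta> \<Longrightarrow> 0 \<le> t \<Longrightarrow> norm (flow F y t) < \<epsilon>"
    using stable unfolding lyapunov_stable_def by force
  obtain s where s: "0 \<le> s" "norm (flow F x s) < \<delta>"
    using meets[OF \<delta>(1)] by blast
  have "dist (flow F x t) 0 < \<epsilon>" if "s \<le> t" for t
    using \<delta>(2)[OF s(2), of "t - s"] flow_add[OF s(1), of "t - s" x] that by simp
  then show "\<forall>\<^sub>F t in at_top. dist (flow F x t) 0 < \<epsilon>"
    by (auto simp: eventually_at_top_linorder)
qed

text \<open>Used in two ways: \<open>w = 0\<close> gives monotonicity of \<open>V\<close> along the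
  trajectory, and \<open>w > 0\<close> gives linear decay.\<close>

lemma dissipation_bound:
  fixes V W :: "'a \<Rightarrow> real"
  assumes deriv: "\<And>t. 0 \<le> t \<Longrightarrow>
      ((\<lambda>s. V (flow F x s)) has_real_derivative - W (flow F x t)) (at t within {0..})"
    and W: "\<And>t. 0 \<le> t \<Longrightarrow> w \<le> W (flow F x t)" and t: "0 \<le> t"
  shows "V (flow F x t) + w * t \<le> V x"
proof -
  define v where "v s = V (flow F x s) + w * s" for s
  have v: "(v has_real_derivative w - W (flow F x s)) (at s within {0..})" if "0 \<le> s" for s
    unfolding v_def using deriv[OF that] by (auto intro!: derivative_eq_intros)
  have "v t \<le> v 0"
  proof (rule DERIV_nonpos_imp_decreasing_open[OF t])
    fix s assume s: "0 < s" "s < t"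
    have "at s within {0..} = at s"
      using s by (intro at_within_interior) auto
    then show "\<exists>y. DERIV v s :> y \<and> y \<le> 0"
      using v[of s] W[of s] s by auto
  next
    have "continuous_on {0..} v"
      by (rule DERIV_continuous_on[OF v]) simp
    then show "continuous_on {0..t} v"
      by (rule continuous_on_subset) auto
  qed
  then show ?thesis by (simp add: v_def flow_0)
qed

text \<open>A trajectory that avoids \<open>S\<close> forever loses \<open>V\<close> at rate at
  least \<open>w\<close>, which a nonnegative \<open>V\<close> cannot sustain.\<close>

lemma flow_meets:
  fixes V W :: "'a \<Rightarrow> real"
  assumes deriv: "\<And>t. 0 \<le> t \<Longrightarrow>
      ((\<lambda>s. V (flow F x s)) has_real_derivative - W (flow F x t)) (at t within {0..})"
    and V: "\<And>y. 0 \<le> V y"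
    and w: "0 < w" "\<And>t. 0 \<le> t \<Longrightarrow> flow F x t \<notin> S \<Longrightarrow> w \<le> W (flow F x t)"
  shows "\<exists>t\<ge>0. flow F x t \<in> S"
proof (rule ccontr)
  assume "\<not> ?thesis"
  then have "V (flow F x t) + w * t \<le> V x" if "0 \<le> t" for t
    using that by (intro dissipation_bound[OF deriv w(2)]) auto
  \<comment> \<open>At time \<open>V x / w + 1\<close> the bound would force \<open>V\<close> down
    to \<open>- w\<close> or less.\<close>
  moreover have "w * (V x / w + 1) = V x + w" "0 \<le> V x / w + 1"
    using w(1) V[of x] by (simp_all add: field_simps)
  ultimately show False
    using w(1) V[of "flow F x (V x / w + 1)"] by force
qed

text \<open>Positivity of \<open>W\<close> alone gives no uniform rate. Boundedness confines the
  trajectory outside the \<delta>-ball to a compact annulus, on which \<open>W\<close> has a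
  positive lower bound.\<close>

lemma flow_tendsto_0_bounded:
  fixes V W :: "'a \<Rightarrow> real"
  assumes stable: "lyapunov_stable F 0"
    and deriv: "\<And>t. 0 \<le> t \<Longrightarrow>
      ((\<lambda>s. V (flow F x s)) has_real_derivative - W (flow F x t)) (at t within {0..})"
    and V: "\<And>y. 0 \<le> V y"
    and W: "continuous_on UNIV W" "\<And>y. y \<noteq> 0 \<Longrightarrow> 0 < W y"
    and bounded: "\<And>t. 0 \<le> t \<Longrightarrow> norm (flow F x t) \<le> R"
  shows "(flow F x \<longlongrightarrow> 0) at_top"
proof (rule flow_tendsto_0[OF stable])
  fix \<delta> :: real assume \<delta>: "0 < \<delta>"
  obtain w where w: "0 < w" "\<And>y. y \<in> cball 0 R - ball 0 \<delta> \<Longrightarrow> w \<le> W y"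
  proof (rule compact_pos_lower_bound)
    show "compact (cball (0::'a) R - ball 0 \<delta>)" by (simp add: compact_diff)
    show "continuous_on (cball 0 R - ball 0 \<delta>) W"
      using W(1) by (rule continuous_on_subset) simp
    show "0 < W y" if "y \<in> cball 0 R - ball 0 \<delta>" for y
      using that \<delta> by (intro W(2)) auto
  qed (rule that)
  have "\<exists>t\<ge>0. flow F x t \<in> ball 0 \<delta>"
    by (rule flow_meets[OF deriv V w(1)]) (use w(2) bounded in auto)
  then show "\<exists>s\<ge>0. norm (flow F x s) < \<delta>" by simp
qed

end

section \<open>Discounted cost along the flow\<close>

context complete_system
begin

text \<open>Bellman's principle: split the integral at time \<open>s\<close>, translate the tail by
  \<open>s\<close>, and apply the semigroup law to recognize the cost from the state
  reached.\<close>

lemma discounted_cost_split: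
  fixes g :: "'a \<Rightarrow> real" and \<gamma> :: real
  defines "D \<equiv> \<lambda>x. \<integral>\<^sup>+ t\<in>{0..}. ennreal (\<gamma> powr t * g (flow F x t)) \<partial>lborel"
  assumes \<gamma>: "0 < \<gamma>" and g: "continuous_on UNIV g" "\<And>x. 0 \<le> g x" and s: "0 \<le> s"
  shows "D x = ennreal (integral {0..s} (\<lambda>t. \<gamma> powr t * g (flow F x t))) +
    ennreal (\<gamma> powr s) * D (flow F x s)"
proof -
  \<comment> \<open>\<open>flow\<close> has junk values at negative times; clamping makes the integrand continuous on \<open>\<real>\<close>.\<close>
  define h where "h y t = \<gamma> powr t * g (flow F y (max 0 t))" for y t
  have h_cont: "continuous_on UNIV (h y)" for y
  proof -
    have "continuous_on UNIV (\<lambda>t::real. flow F y (max 0 t))"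
      by (rule continuous_on_compose2[OF flow_continuous]) (auto intro!: continuous_intros)
    then have "continuous_on UNIV (\<lambda>t::real. g (flow F y (max 0 t)))"
      by (rule continuous_on_compose2[OF g(1)]) simp
    then show ?thesis
      unfolding h_def using \<gamma> by (intro continuous_intros) auto
  qed
  have h_meas [measurable]: "h y \<in> borel_measurable borel" for y
    using h_cont by (rule borel_measurable_continuous_onI)
  have h_nonneg: "0 \<le> h y t" for y t
    unfolding h_def using g by simp
  have D: "D y = (\<integral>\<^sup>+ t\<in>{0..}. ennreal (h y t) \<partial>lborel)" for y
    unfolding D_def by (intro nn_integral_cong) (auto simp: h_def indicator_def)
  have I: "integral {0..s} (h x) = integral {0..s} (\<lambda>t. \<gamma> powr t * g (flow F x t))"
    by (rule integral_cong) (simp add: h_def)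
  have "(h x has_integral integral {0..s} (h x)) {0..s}"
    by (intro integrable_integral integrable_continuous_real continuous_on_subset[OF h_cont]) simp
  note nn_integral_h = nn_integral_has_integral_lebesgue'[OF h_nonneg this]
  have "D x = (\<integral>\<^sup>+ t\<in>{0..<s} \<union> {s..}. ennreal (h x t) \<partial>lborel)"
    unfolding D using s by (simp add: ivl_disj_un)
  also have "\<dots> = (\<integral>\<^sup>+ t\<in>{0..<s}. ennreal (h x t) \<partial>lborel) + (\<integral>\<^sup>+ t\<in>{s..}. ennreal (h x t) \<partial>lborel)"
    by (rule nn_integral_disjoint_pair) auto
  \<comment> \<open>The half-open interval made the pieces disjoint; adding the null set
    \<open>{s}\<close> returns to the closed interval of \<open>integral\<close>.\<close>
  also have "(\<integral>\<^sup>+ t\<in>{0..<s}. ennreal (h x t) \<partial>lborel) = (\<integral>\<^sup>+ t\<in>{0..s}. ennreal (h x t) \<partial>lborel)"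
  proof (rule nn_integral_null_delta)
    have "{0..<s} - {0..s} \<union> ({0..s} - {0..<s}) = {s}" using s by auto
    moreover have "{s} \<in> null_sets lborel" by (rule null_setsI) auto
    ultimately show "{0..<s} - {0..s} \<union> ({0..s} - {0..<s}) \<in> null_sets lborel" by simp
  qed auto
  also have "\<dots> = ennreal (integral {0..s} (\<lambda>t. \<gamma> powr t * g (flow F x t)))"
    using nn_integral_h by (simp add: I)
  also have "(\<integral>\<^sup>+ t\<in>{s..}. ennreal (h x t) \<partial>lborel) =
      (\<integral>\<^sup>+ t. ennreal (h x (s + t)) * indicator {s..} (s + t) \<partial>lborel)"
    by (subst nn_integral_real_affine[where c = 1 and t = s]) auto
  also have "\<dots> = (\<integral>\<^sup>+ t. ennreal (\<gamma> powr s) * (ennreal (h (flow F x s) t) * indicator {0..} t) \<partial>lborel)"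
    by (intro nn_integral_cong)
      (use s \<gamma> in \<open>auto simp: h_def indicator_def powr_add flow_add mult.assoc ennreal_mult'[symmetric]\<close>)
  also have "\<dots> = ennreal (\<gamma> powr s) * D (flow F x s)"
    unfolding D by (rule nn_integral_cmult) simp
  finally show ?thesis .
qed

text \<open>Solving Bellman's identity for the value at the state reached leaves an exponential
  times a constant minus an integral; the product rule and the fundamental theorem of calculus
  differentiate it.\<close>

lemma discounted_cost_deriv:
  fixes g J :: "'a \<Rightarrow> real"
  assumes \<gamma>: "0 < \<gamma>" and g: "continuous_on UNIV g" "\<And>x. 0 \<le> g x"
    and J: "\<And>x. 0 \<le> J x"
      "\<And>x. (\<integral>\<^sup>+ t\<in>{0..}. ennreal (\<gamma> powr t * g (flow F x t)) \<partial>lborel) = ennreal (J x)"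
    and t: "0 \<le> t"
  shows "((\<lambda>s. J (flow F x s)) has_real_derivative
    - (g (flow F x t) - (- ln \<gamma>) * J (flow F x t))) (at t within {0..})"
proof -
  define I where "I s = integral {0..s} (\<lambda>t. \<gamma> powr t * g (flow F x t))" for s
  have I_nonneg: "0 \<le> I s" for s
    \<comment> \<open>If the integrand is not integrable, \<open>integral\<close> defaults to 0, so
      the sign is right in either case.\<close>
    unfolding I_def by (cases "(\<lambda>t. \<gamma> powr t * g (flow F x t)) integrable_on {0..s}")
      (auto intro!: integral_nonneg simp: g not_integrable_integral)
  have "J x = I s + \<gamma> powr s * J (flow F x s)" if "0 \<le> s" for s
    using discounted_cost_split[OF \<gamma> g that, of x] J(1) I_nonneg
    by (simp add: J(2) I_def[symmetric] ennreal_mult'[symmetric] ennreal_plus[symmetric] del: ennreal_plus)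
  then have J_flow: "J (flow F x s) = \<gamma> powr (- s) * (J x - I s)" if "0 \<le> s" for s
    using \<gamma> that by (simp add: powr_minus field_simps)
  \<comment> \<open>Going up to \<open>t + 1\<close> keeps \<open>t\<close> from being a right
    endpoint, so the derivative within this interval is the one within \<open>{0..}\<close>.\<close>
  have cont: "continuous_on {0..t + 1} (\<lambda>t. \<gamma> powr t * g (flow F x t))"
    using \<gamma> by (intro continuous_intros continuous_on_compose2[OF g(1)]
        continuous_on_subset[OF flow_continuous]) auto
  have "(I has_real_derivative \<gamma> powr t * g (flow F x t)) (at t within {0..t + 1})"
    unfolding I_def using t by (intro integral_has_real_derivative[OF cont]) auto
  moreover have "at t within {0..t + 1} = at t within {0..}"
    by (rule at_within_nhd[of _ "{..<t + 1}"]) auto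
  ultimately have "(I has_real_derivative \<gamma> powr t * g (flow F x t)) (at t within {0..})"
    by simp
  moreover have "((\<lambda>s. \<gamma> powr (- s)) has_real_derivative - ln \<gamma> * \<gamma> powr (- t)) (at t within {0..})"
    using \<gamma> by (auto simp: powr_def intro!: derivative_eq_intros)
  moreover have "\<gamma> powr (- t) * \<gamma> powr t = 1"
    using \<gamma> by (simp add: powr_minus)
  ultimately have "((\<lambda>s. \<gamma> powr (- s) * (J x - I s)) has_real_derivative
      - (g (flow F x t) - (- ln \<gamma>) * (\<gamma> powr (- t) * (J x - I t)))) (at t within {0..})"
    by - (rule DERIV_cong[OF DERIV_mult[OF _ DERIV_diff[OF DERIV_const]]], assumption+, algebra)
  then show ?thesis
    unfolding J_flow[OF t, symmetric]
    by (rule has_field_derivative_transform_within[where d = 1]) (use t J_flow in auto)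
qed

end

section \<open>Radial growth\<close>

lemma
  fixes g :: "'a::euclidean_space \<Rightarrow> real"
  shows radial_Inf_le: "\<rho> \<le> norm x \<Longrightarrow> (INF x\<in>{x. \<rho> \<le> norm x}. \<bar>g x\<bar>) \<le> \<bar>g x\<bar>"
    and radial_Inf_nonneg: "0 \<le> (INF x\<in>{x. \<rho> \<le> norm x}. \<bar>g x\<bar>)"
proof -
  show "\<rho> \<le> norm x \<Longrightarrow> (INF x\<in>{x. \<rho> \<le> norm x}. \<bar>g x\<bar>) \<le> \<bar>g x\<bar>"
    by (intro cINF_lower bdd_belowI[of _ 0]) auto
  \<comment> \<open>The exterior of every ball must be seen to be nonempty, since the infimum over
    an empty set has no known sign.\<close>
  obtain y :: 'a where "norm y = max 0 \<rho>"
    using vector_choose_size[of "max 0 \<rho>"] by auto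
  then have "y \<in> {x. \<rho> \<le> norm x}" by simp
  then have "{x :: 'a. \<rho> \<le> norm x} \<noteq> {}" by blast
  then show "0 \<le> (INF x\<in>{x. \<rho> \<le> norm x}. \<bar>g x\<bar>)"
    by (intro cINF_greatest) auto
qed

text \<open>If the infimum were 0 at every radius, it would converge to 0; being nonnegative, it is
  therefore positive at some radius.\<close>

lemma radially_nonvanishingD:
  fixes g :: "'a::euclidean_space \<Rightarrow> real"
  assumes "radially_nonvanishing g"
  obtains \<rho> \<eta> where "0 < \<eta>" "\<And>x. \<rho> \<le> norm x \<Longrightarrow> \<eta> \<le> \<bar>g x\<bar>"
proof -
  have "\<exists>\<rho>. (INF x\<in>{x. \<rho> \<le> norm x}. \<bar>g x\<bar>) \<noteq> 0"
  proof (rule ccontr)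
    assume "\<not> ?thesis"
    then show False
      using assms by (simp add: radially_nonvanishing_def)
  qed
  then obtain \<rho> where \<rho>: "0 < (INF x\<in>{x. \<rho> \<le> norm x}. \<bar>g x\<bar>)"
    using radial_Inf_nonneg[where g = g] by (metis order_le_imp_less_or_eq)
  show ?thesis
    by (rule that[OF \<rho>]) (rule radial_Inf_le)
qed

text \<open>The form in which growth is used: a trajectory that stays in a sublevel set is
  bounded.\<close>

lemma radially_unboundedD:
  fixes g :: "'a::euclidean_space \<Rightarrow> real"
  assumes "radially_unbounded g"
  obtains R where "\<And>x. \<bar>g x\<bar> \<le> a \<Longrightarrow> norm x \<le> R"
proof -
  have "\<forall>\<^sub>F \<rho> in at_top. a < (INF x\<in>{x. \<rho> \<le> norm x}. \<bar>g x\<bar>)"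
    using assms unfolding radially_unbounded_def filterlim_at_top_dense by blast
  then obtain \<rho> where \<rho>: "a < (INF x\<in>{x. \<rho> \<le> norm x}. \<bar>g x\<bar>)"
    by (auto simp: eventually_at_top_linorder)
  show ?thesis
  proof (rule that[of \<rho>])
    fix x assume "\<bar>g x\<bar> \<le> a"
    then show "norm x \<le> \<rho>"
      using radial_Inf_le[where \<rho> = \<rho> and x = x and g = g] \<rho> by linarith
  qed
qed

text \<open>Far out the bound comes from radial nonvanishing; on the remaining annulus it comes from
  compactness.\<close>

lemma nonvanishing_pos_lower_bound:
  fixes g :: "'a::euclidean_space \<Rightarrow> real"
  assumes "radially_nonvanishing g" "continuous_on UNIV g" "\<And>x. x \<noteq> 0 \<Longrightarrow> 0 < g x" "0 < \<delta>"
  obtains w where "0 < w" "\<And>x. \<delta> \<le> norm x \<Longrightarrow> w \<le> g x"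
proof -
  obtain \<rho> \<eta> where \<eta>: "0 < \<eta>" "\<And>x. \<rho> \<le> norm x \<Longrightarrow> \<eta> \<le> \<bar>g x\<bar>"
    using radially_nonvanishingD[OF assms(1)] by blast
  obtain w where w: "0 < w" "\<And>x. x \<in> cball 0 \<rho> - ball 0 \<delta> \<Longrightarrow> w \<le> g x"
  proof (rule compact_pos_lower_bound)
    show "compact (cball (0::'a) \<rho> - ball 0 \<delta>)" by (simp add: compact_diff)
    show "continuous_on (cball 0 \<rho> - ball 0 \<delta>) g"
      using assms(2) by (rule continuous_on_subset) simp
    show "0 < g x" if "x \<in> cball 0 \<rho> - ball 0 \<delta>" for x
      using that assms(4) by (intro assms(3)) auto
  qed (rule that)
  show ?thesis
  proof (rule that[of "min w \<eta>"])
    fix x :: 'a assume x: "\<delta> \<le> norm x"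
    then have "0 < g x" using assms(4) by (intro assms(3)) auto
    then show "min w \<eta> \<le> g x"
      using w(2)[of x] \<eta>(2)[of x] x by (cases "\<rho> \<le> norm x") auto
  qed (use w \<eta> in auto)
qed

section \<open>The closed-loop system\<close>

lemma locally_lipschitz_on_compact:
  assumes "locally_lipschitz_on S g" "compact K" "K \<subseteq> S"
  shows "\<exists>L. L-lipschitz_on K g"
proof -
  \<comment> \<open>The dummy time is restricted to one point, so that the time set is compact
    too.\<close>
  have ll: "local_lipschitz {0::real} K (\<lambda>_. g)"
    using assms unfolding locally_lipschitz_on_def by (auto intro: local_lipschitz_subset)
  obtain L where "\<And>t. t \<in> {0::real} \<Longrightarrow> L-lipschitz_on K g"
    by (rule local_lipschitz_compact_implies_lipschitz[OF ll assms(2)]) auto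
  then show ?thesis by auto
qed

text \<open>The graph of \<pi> over \<open>K\<close> is a compact subset of
  \<open>UNIV \<times> U\<close>, so \<open>f\<close> is Lipschitz on it; composing with the
  Lipschitz map onto the graph gives the bound.\<close>

lemma closed_loop_lipschitz_compact:
  assumes f: "locally_lipschitz_on (UNIV \<times> U) (\<lambda>(x, u). f x u)"
    and \<pi>: "\<pi> \<in> policies\<^sub>0 U" and K: "compact K"
  shows "\<exists>L. L-lipschitz_on K (closed_loop f \<pi>)"
proof -
  have \<pi>': "locally_lipschitz_on UNIV \<pi>" "continuous_on UNIV \<pi>" "\<And>x. \<pi> x \<in> U"
    using \<pi> by (auto simp: policies\<^sub>0_def policies_def)
  obtain L where L: "L-lipschitz_on K \<pi>"
    using locally_lipschitz_on_compact[OF \<pi>'(1) K] by auto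
  have graph: "(sqrt (1\<^sup>2 + L\<^sup>2))-lipschitz_on K (\<lambda>x. (x, \<pi> x))"
    by (intro lipschitz_on_Pair lipschitz_on_id L)
  have "compact ((\<lambda>x. (x, \<pi> x)) ` K)"
    using K \<pi>'(2) by (intro compact_continuous_image continuous_intros)
      (auto intro: continuous_on_subset)
  then obtain M where "M-lipschitz_on ((\<lambda>x. (x, \<pi> x)) ` K) (\<lambda>(x, u). f x u)"
    using locally_lipschitz_on_compact[OF f] \<pi>'(3) by blast
  from lipschitz_on_compose2[OF graph this] show ?thesis
    by (auto simp: closed_loop_def[abs_def])
qed

theorem theorem5p13:
  fixes U :: "(real ^ 'm) set"
    and f :: "real ^ 'l \<Rightarrow> real ^ 'm \<Rightarrow> real ^ 'l"
    and c :: "real ^ 'l \<Rightarrow> real ^ 'm \<Rightarrow> real"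
    and ustar :: "real ^ 'l \<Rightarrow> real ^ 'l \<Rightarrow> real ^ 'm"
    and \<gamma> \<alpha> :: real
    and \<pi> :: "real ^ 'l \<Rightarrow> real ^ 'm"
  assumes U: "\<exists>S. open S \<and> (U = S \<union> frontier S \<or> U = S)" "0 \<in> U"
    and f_lipschitz: "locally_lipschitz_on (UNIV \<times> U) (\<lambda>(x, u). f x u)"
    and f_zero: "f 0 0 = 0"
    and c_continuous: "continuous_on (UNIV \<times> U) (\<lambda>(x, u). c x u)"
    and c_zero: "c 0 0 = 0"
    and c_pos: "\<And>x u. u \<in> U \<Longrightarrow> (x, u) \<noteq> (0, 0) \<Longrightarrow> c x u > 0"
    and \<gamma>: "0 < \<gamma>" "\<gamma> \<le> 1"
    and \<alpha>: "\<alpha> = - ln \<gamma>"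
    and ustar_lipschitz: "locally_lipschitz_on UNIV (\<lambda>(x, p). ustar x p)"
    and ustar_argmax: "\<And>x p. is_arg_max (\<lambda>u. hamiltonian c f x u p) (\<lambda>u. u \<in> U) (ustar x p)"
    and value_regular: "\<And>\<mu>. \<mu> \<in> admissible U \<gamma> f c \<Longrightarrow>
           C1_locally_lipschitz_gradient (\<lambda>x. - cost \<gamma> f c \<mu> x)"
    and c_nonvanishing: "\<And>\<mu>. \<mu> \<in> policies\<^sub>0 U \<Longrightarrow> radially_nonvanishing (closed_loop c \<mu>)"
    and \<pi>_admissible: "\<pi> \<in> admissible U \<gamma> f c"
  shows "((\<forall>x. \<alpha> * cost \<gamma> f c \<pi> x \<le> closed_loop c \<pi> x) \<longrightarrow>
            lyapunov_stable (closed_loop f \<pi>) 0) \<and>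
         ((\<forall>x. x \<noteq> 0 \<longrightarrow> \<alpha> * cost \<gamma> f c \<pi> x < closed_loop c \<pi> x) \<longrightarrow>
            asymptotically_stable (closed_loop f \<pi>) 0) \<and>
         (\<gamma> = 1 \<or>
          (\<forall>x. x \<noteq> 0 \<longrightarrow> \<alpha> * cost \<gamma> f c \<pi> x < closed_loop c \<pi> x) \<and>
            radially_unbounded (cost \<gamma> f c \<pi>) \<longrightarrow>
            globally_asymptotically_stable (closed_loop f \<pi>) 0)"
proof -
  let ?F = "closed_loop f \<pi>" and ?g = "closed_loop c \<pi>" and ?J = "cost \<gamma> f c \<pi>"
  \<comment> \<open>The rate at which \<open>?J\<close> decreases along trajectories; the conditions
    of (1) and (2) are its nonnegativity and its positivity off the origin.\<close>
  let ?W = "\<lambda>x. ?g x - \<alpha> * ?J x"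
  have \<pi>: "\<pi> \<in> policies\<^sub>0 U" and finite_cost: "\<And>x. cost_ext \<gamma> f c \<pi> x < \<infinity>"
    using \<pi>_admissible by (auto simp: admissible_def)
  have \<pi>': "continuous_on UNIV \<pi>" "\<And>x. \<pi> x \<in> U" "\<pi> 0 = 0"
    using \<pi> by (auto simp: policies\<^sub>0_def policies_def)
  have t_max: "t_max ?F x = \<infinity>" for x
    using finite_cost[of x] by (auto simp: cost_ext_def split: if_splits)
  interpret complete_system ?F
    by unfold_locales (auto intro: closed_loop_lipschitz_compact[OF f_lipschitz \<pi>] t_max)
  have F0: "?F 0 = 0"
    by (simp add: closed_loop_def \<pi>' f_zero)
  have g_cont: "continuous_on UNIV ?g"
  proof -
    have "continuous_on UNIV (\<lambda>x. (\<lambda>(x, u). c x u) (x, \<pi> x))"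
      by (rule continuous_on_compose2[OF c_continuous]) (auto intro!: continuous_intros \<pi>')
    then show ?thesis by (simp add: closed_loop_def[abs_def])
  qed
  have g_pos: "0 < ?g x" if "x \<noteq> 0" for x
    unfolding closed_loop_def using that by (intro c_pos \<pi>') auto
  have g0: "?g 0 = 0"
    by (simp add: closed_loop_def \<pi>' c_zero)
  have g_nonneg: "0 \<le> ?g x" for x
    using g_pos[of x] g0 by (cases "x = 0") auto
  have J_nonneg: "0 \<le> ?J x" for x
    by (simp add: cost_def)
  \<comment> \<open>Finiteness of the cost makes the passage through \<open>enn2real\<close>
    lossless.\<close>
  have J_eq: "(\<integral>\<^sup>+ t\<in>{0..}. ennreal (\<gamma> powr t * ?g (flow ?F x t)) \<partial>lborel) = ennreal (?J x)" for x
    using finite_cost[of x] by (simp add: cost_def cost_ext_def t_max)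
  have J_deriv: "((\<lambda>s. ?J (flow ?F x s)) has_real_derivative - ?W (flow ?F x t)) (at t within {0..})"
    if "0 \<le> t" for x t
    unfolding \<alpha> by (rule discounted_cost_deriv[OF \<gamma>(1) g_cont g_nonneg J_nonneg J_eq that])
  have J_cont: "continuous_on UNIV ?J"
  proof -
    have "continuous_on UNIV (\<lambda>x. - ?J x)"
      using value_regular[OF \<pi>_admissible]
      unfolding C1_locally_lipschitz_gradient_def gderiv_def continuous_on_eq_continuous_at[OF open_UNIV]
      by (auto intro: has_derivative_continuous)
    from continuous_on_minus[OF this] show ?thesis
      by simp
  qed
  have J0: "?J 0 = 0"
  proof -
    have "(\<integral>\<^sup>+ t\<in>{0..}. ennreal (\<gamma> powr t * ?g (flow ?F 0 t)) \<partial>lborel) = (\<integral>\<^sup>+ (t::real). 0 \<partial>lborel)"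
      by (intro nn_integral_cong) (auto simp: indicator_def flow_equilibrium F0 g0)
    then show ?thesis
      using J_eq[of 0] J_nonneg[of 0] by simp
  qed
  have J_pos: "0 < ?J x" if x: "x \<noteq> 0" for x
  proof (rule ccontr)
    assume "\<not> ?thesis"
    then have Jx: "?J x = 0" using J_nonneg[of x] by simp
    \<comment> \<open>Otherwise \<open>?J\<close> vanishes at time \<open>0\<close> with derivative \<open>- ?g x < 0\<close>, so it becomes negative.\<close>
    have "((\<lambda>s. ?J (flow ?F x s)) has_real_derivative - ?g x) (at 0 within {0..})"
      using J_deriv[of 0 x] by (simp add: flow_0 Jx)
    then obtain d where "0 < d" "\<And>h. 0 < h \<Longrightarrow> 0 + h \<in> {0..} \<Longrightarrow> h < d \<Longrightarrow>
        ?J (flow ?F x (0 + h)) < ?J (flow ?F x 0)"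
      using has_real_derivative_neg_dec_right[of "\<lambda>s. ?J (flow ?F x s)" "- ?g x" 0 "{0..}"]
        g_pos[OF x] by auto
    from this(1) this(2)[of "d / 2"] show False
      using J_nonneg[of "flow ?F x (d / 2)"] by (simp add: flow_0 Jx)
  qed
  have W_cont: "continuous_on UNIV ?W"
    by (intro continuous_intros g_cont J_cont)
  have J_decreasing: "?J (flow ?F x t) \<le> ?J x" if "\<forall>x. \<alpha> * ?J x \<le> ?g x" "0 \<le> t" for x t
    using dissipation_bound[of ?J x ?W 0 t, OF J_deriv] that by simp
  have stable: "lyapunov_stable ?F 0" if "\<forall>x. \<alpha> * ?J x \<le> ?g x"
    by (rule lyapunov_stable_0I[OF F0 J_cont J0 J_pos J_decreasing[OF that]])
  \<comment> \<open>At the origin both sides are 0.\<close>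
  have weak: "\<forall>x. \<alpha> * ?J x \<le> ?g x" if "\<forall>x. x \<noteq> 0 \<longrightarrow> \<alpha> * ?J x < ?g x"
    using that J0 g0 by (metis less_imp_le mult_zero_right order_refl)
  have asymptotic: "asymptotically_stable ?F 0" if strict: "\<forall>x. x \<noteq> 0 \<longrightarrow> \<alpha> * ?J x < ?g x"
  proof -
    note st = stable[OF weak[OF strict]]
    \<comment> \<open>Stability with \<epsilon> = 1 confines nearby trajectories to the unit ball,
      which supplies the bound needed for convergence.\<close>
    obtain \<delta> where \<delta>: "0 < \<delta>" "\<And>x t. norm x < \<delta> \<Longrightarrow> 0 \<le> t \<Longrightarrow> norm (flow ?F x t) < 1"
      using st unfolding lyapunov_stable_def by (metis diff_zero zero_less_one)
    have "(flow ?F x \<longlongrightarrow> 0) at_top" if "norm x < \<delta>" for x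
      by (rule flow_tendsto_0_bounded[OF st J_deriv J_nonneg W_cont, where R = 1])
        (use strict \<delta>(2)[OF that] in \<open>auto intro: less_imp_le\<close>)
    then show ?thesis
      unfolding asymptotically_stable_def using st \<delta>(1) t_max by auto
  qed
  have global_undiscounted: "globally_asymptotically_stable ?F 0" if "\<gamma> = 1"
  proof -
    \<comment> \<open>Without discounting, \<open>?W\<close> is the cost rate \<open>?g\<close>
      itself, so the condition of (1) holds automatically.\<close>
    have \<alpha>0: "\<alpha> = 0" using that \<alpha> by simp
    then have st: "lyapunov_stable ?F 0"
      by (intro stable) (simp add: g_nonneg)
    have "(flow ?F x \<longlongrightarrow> 0) at_top" for x
    proof (rule flow_tendsto_0[OF st])
      fix \<delta> :: real assume "0 < \<delta>"
      then obtain w where w: "0 < w" "\<And>x. \<delta> \<le> norm x \<Longrightarrow> w \<le> ?g x"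
        using nonvanishing_pos_lower_bound[OF c_nonvanishing[OF \<pi>] g_cont g_pos] by blast
      \<comment> \<open>The bound \<open>w\<close> holds on the whole exterior of the ball, so the
        trajectory may be unbounded before it enters.\<close>
      have "\<exists>t\<ge>0. flow ?F x t \<in> ball 0 \<delta>"
        by (rule flow_meets[OF J_deriv J_nonneg w(1)]) (use w(2) \<alpha>0 in auto)
      then show "\<exists>s\<ge>0. norm (flow ?F x s) < \<delta>" by simp
    qed
    then show ?thesis
      unfolding globally_asymptotically_stable_def using st t_max by auto
  qed
  have global_unbounded: "globally_asymptotically_stable ?F 0"
    if strict: "\<forall>x. x \<noteq> 0 \<longrightarrow> \<alpha> * ?J x < ?g x" and unbounded: "radially_unbounded ?J"
  proof -
    note st = stable[OF weak[OF strict]]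
    have "(flow ?F x \<longlongrightarrow> 0) at_top" for x
    proof -
      \<comment> \<open>\<open>?J\<close> never exceeds its initial value along the trajectory, so
        \<open>R\<close> bounds all of it.\<close>
      obtain R where R: "\<And>y. \<bar>?J y\<bar> \<le> ?J x \<Longrightarrow> norm y \<le> R"
        using radially_unboundedD[OF unbounded] by blast
      show ?thesis
        by (rule flow_tendsto_0_bounded[OF st J_deriv J_nonneg W_cont, where R = R])
          (use strict J_decreasing[OF weak[OF strict]] J_nonneg in \<open>auto intro!: R\<close>)
    qed
    then show ?thesis
      unfolding globally_asymptotically_stable_def using st t_max by auto
  qed
  show ?thesis
    using stable asymptotic global_undiscounted global_unbounded by blast
qed

end
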